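(* Let $R$ be either $\mathbf{Z}$ or $\mathbf{R}$ and let $h\ge 1$. Then the operator norm of the map $$H^2_b(\mathrm{Sp}_{2(h+k)}(R);\mathbf{R})\to H^2_b(\mathrm{Sp}_{2h}(R);\mathbf{R})$$ induced by the stabilization inclusion $\mathrm{Sp}_{2h}(R)\to\mathrm{Sp}_{2(h+k)}(R)$ tends to $0$ as $k\to\infty$.
   Context: $\mathrm{Sp}_{2h}(R)$ is the group of automorphisms of $R^{2h}$ preserving the standard symplectic form, regarded as a discrete group. The stabilization inclusion extends an automorphism by the identity on the orthogonal summand $R^{2k}$ of $R^{2(h+k)}=R^{2h}\oplus R^{2k}$. $H^2_b(\Gamma;\mathbf{R})$ is the second bounded cohomology of the discrete group $\Gamma$ (cohomology of the complex of bounded real cochains), equipped with the norm induced by the sup-norm on cochains (the infimum of sup-norms of bounded cocycles representing the class; in degree $2$ this is a Banach norm). The operator norm is taken with respect to these norms. *)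

theory Defs
  imports Complex_Main "HOL-Algebra.Group" "Jordan_Normal_Form.Matrix"
begin

section \<open>Symplectic groups and stabilization\<close>

text \<open>
  The basis of the free module of rank \<open>2 * h\<close> is ordered as
  \<open>e\<^sub>0, f\<^sub>0, e\<^sub>1, f\<^sub>1, \<dots>\<close> with \<open>\<omega>(e\<^sub>i, f\<^sub>i) = 1\<close>. With this ordering the
  orthogonal decomposition of rank \<open>2 * (h + k)\<close> into ranks \<open>2 * h\<close> and \<open>2 * k\<close>
  is the splitting of coordinates into the first \<open>2 * h\<close> and the last \<open>2 * k\<close>.
\<close>

definition symp_form :: "nat \<Rightarrow> 'a::comm_ring_1 vec \<Rightarrow> 'a vec \<Rightarrow> 'a" where
  "symp_form h v w = (\<Sum>i<h. v $ (2 * i) * w $ (2 * i + 1) - v $ (2 * i + 1) * w $ (2 * i))"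

definition Sp :: "nat \<Rightarrow> 'a::comm_ring_1 mat monoid" where
  "Sp h = \<lparr>carrier = {A \<in> carrier_mat (2 * h) (2 * h). invertible_mat A \<and>
              (\<forall>v \<in> carrier_vec (2 * h). \<forall>w \<in> carrier_vec (2 * h).
                 symp_form h (A *\<^sub>v v) (A *\<^sub>v w) = symp_form h v w)},
           mult = (*), one = 1\<^sub>m (2 * h)\<rparr>"

definition stab :: "nat \<Rightarrow> 'a::comm_ring_1 mat \<Rightarrow> 'a mat" where
  "stab k A = four_block_mat A (0\<^sub>m (dim_row A) (2 * k)) (0\<^sub>m (2 * k) (dim_col A)) (1\<^sub>m (2 * k))"


section \<open>Bounded cohomology of discrete groups\<close>

text \<open>
  Homogeneous bounded cochains with trivial real coefficients. An \<open>n\<close>-cochain is an invariant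
  bounded function on \<open>(n+1)\<close>-tuples (lists) in the carrier; it is required to vanish on all other
  lists, so that cochains are determined by their values on tuples.
\<close>

definition tuples :: "('g, 'm) monoid_scheme \<Rightarrow> nat \<Rightarrow> 'g list set" where
  "tuples G n = {xs. length xs = n + 1 \<and> set xs \<subseteq> carrier G}"

definition bdd_cochains :: "('g, 'm) monoid_scheme \<Rightarrow> nat \<Rightarrow> ('g list \<Rightarrow> real) set" where
  "bdd_cochains G n =
     {f. (\<forall>xs. xs \<notin> tuples G n \<longrightarrow> f xs = 0) \<and>
         (\<forall>g \<in> carrier G. \<forall>xs \<in> tuples G n. f (map (\<lambda>x. g \<otimes>\<^bsub>G\<^esub> x) xs) = f xs) \<and>
         bdd_above ((\<lambda>xs. \<bar>f xs\<bar>) ` tuples G n)}"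

definition sup_norm :: "('g, 'm) monoid_scheme \<Rightarrow> nat \<Rightarrow> ('g list \<Rightarrow> real) \<Rightarrow> real" where
  "sup_norm G n f = (SUP xs \<in> tuples G n. \<bar>f xs\<bar>)"

definition coboundary :: "('g, 'm) monoid_scheme \<Rightarrow> nat \<Rightarrow> ('g list \<Rightarrow> real) \<Rightarrow> 'g list \<Rightarrow> real" where
  "coboundary G n f = (\<lambda>xs. if xs \<in> tuples G (n + 1)
     then (\<Sum>i\<le>n + 1. (-1) ^ i * f (take i xs @ drop (i + 1) xs)) else 0)"

definition bdd_cocycles :: "('g, 'm) monoid_scheme \<Rightarrow> nat \<Rightarrow> ('g list \<Rightarrow> real) set" where
  "bdd_cocycles G n = {f \<in> bdd_cochains G n. coboundary G n f = (\<lambda>_. 0)}"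

definition bdd_coboundaries :: "('g, 'm) monoid_scheme \<Rightarrow> nat \<Rightarrow> ('g list \<Rightarrow> real) set" where
  "bdd_coboundaries G n =
     (case n of 0 \<Rightarrow> {\<lambda>_. 0} | Suc m \<Rightarrow> coboundary G m ` bdd_cochains G m)"

definition cohomologous :: "('g, 'm) monoid_scheme \<Rightarrow> nat \<Rightarrow> (('g list \<Rightarrow> real) \<times> ('g list \<Rightarrow> real)) set" where
  "cohomologous G n = {(f, f'). f \<in> bdd_cocycles G n \<and> f' \<in> bdd_cocycles G n \<and>
                                (\<lambda>xs. f xs - f' xs) \<in> bdd_coboundaries G n}"

definition Hb :: "('g, 'm) monoid_scheme \<Rightarrow> nat \<Rightarrow> ('g list \<Rightarrow> real) set set" where
  "Hb G n = bdd_cocycles G n // cohomologous G n"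

definition Hb_norm :: "('g, 'm) monoid_scheme \<Rightarrow> nat \<Rightarrow> ('g list \<Rightarrow> real) set \<Rightarrow> real" where
  "Hb_norm G n c = (INF f \<in> c. sup_norm G n f)"

definition pullback :: "('g, 'm) monoid_scheme \<Rightarrow> nat \<Rightarrow> ('g \<Rightarrow> 'k) \<Rightarrow> ('k list \<Rightarrow> real) \<Rightarrow> 'g list \<Rightarrow> real" where
  "pullback G n \<phi> f = (\<lambda>xs. if xs \<in> tuples G n then f (map \<phi> xs) else 0)"

text \<open>For a homomorphism \<open>\<phi>\<close> defined on \<open>G\<close>, all sets in the following union coincide.\<close>

definition Hb_map :: "('g, 'm) monoid_scheme \<Rightarrow> nat \<Rightarrow> ('g \<Rightarrow> 'k) \<Rightarrow> ('k list \<Rightarrow> real) set \<Rightarrow> ('g list \<Rightarrow> real) set" where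
  "Hb_map G n \<phi> c = (\<Union>f \<in> c. cohomologous G n `` {pullback G n \<phi> f})"

definition Hb_map_norm ::
  "('g, 'm) monoid_scheme \<Rightarrow> ('k, 'l) monoid_scheme \<Rightarrow> nat \<Rightarrow> ('g \<Rightarrow> 'k) \<Rightarrow> real" where
  "Hb_map_norm G K n \<phi> =
     Inf {C. 0 \<le> C \<and> (\<forall>c \<in> Hb K n. Hb_norm G n (Hb_map G n \<phi> c) \<le> C * Hb_norm K n c)}"

end

theory Submission
  imports Defs
begin

text \<open>
  Let \<open>m\<close> be the integer part of \<open>(h + k) / h\<close>. Then \<open>Sp h\<close> embeds in \<open>Sp (h + k)\<close> in \<open>m\<close> ways
  as a diagonal block; the images of these embeddings commute with each other, and permuting the
  blocks shows that the embeddings are conjugate to the stabilization \<open>\<psi>\<close>. In degree 2, bounded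
  cohomology classes are additive on commuting homomorphisms, because the commutator pairing of a
  central extension that is given by a bounded cocycle is a bounded biadditive map and so vanishes.
  For the product \<open>\<Phi>\<close> of the \<open>m\<close> embeddings this gives \<open>\<Phi>\<^sup>* C = m \<psi>\<^sup>* C\<close>. Since pullbacks do not
  increase the norm, \<open>\<psi>\<^sup>*\<close> has norm at most \<open>1 / m\<close>.
\<close>

section \<open>Bounded inhomogeneous 2-cocycles\<close>

text \<open>Inhomogeneous (bar complex) form of differing by the coboundary of a bounded 1-cochain.
  Only the difference of \<open>c\<close> and \<open>d\<close> enters, so the relation can be
  composed, added and scaled without returning to cocycle identities.\<close>

definition bdd_cohomologous2 ::
  "('g, 'm) monoid_scheme \<Rightarrow> ('g \<Rightarrow> 'g \<Rightarrow> real) \<Rightarrow> ('g \<Rightarrow> 'g \<Rightarrow> real) \<Rightarrow> bool" where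
  "bdd_cohomologous2 G c d \<longleftrightarrow> (\<exists>\<beta> B. (\<forall>x \<in> carrier G. \<bar>\<beta> x\<bar> \<le> B) \<and>
     (\<forall>x \<in> carrier G. \<forall>y \<in> carrier G. c x y = d x y + \<beta> x + \<beta> y - \<beta> (x \<otimes>\<^bsub>G\<^esub> y)))"

lemma bdd_cohomologous2_trans:
  assumes "bdd_cohomologous2 G c d" "bdd_cohomologous2 G d e"
  shows "bdd_cohomologous2 G c e"
proof -
  obtain \<beta> B where 1: "\<And>x. x \<in> carrier G \<Longrightarrow> \<bar>\<beta> x\<bar> \<le> B"
      "\<And>x y. x \<in> carrier G \<Longrightarrow> y \<in> carrier G \<Longrightarrow> c x y = d x y + \<beta> x + \<beta> y - \<beta> (x \<otimes>\<^bsub>G\<^esub> y)"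
    using assms(1) unfolding bdd_cohomologous2_def by blast
  obtain \<gamma> C where 2: "\<And>x. x \<in> carrier G \<Longrightarrow> \<bar>\<gamma> x\<bar> \<le> C"
      "\<And>x y. x \<in> carrier G \<Longrightarrow> y \<in> carrier G \<Longrightarrow> d x y = e x y + \<gamma> x + \<gamma> y - \<gamma> (x \<otimes>\<^bsub>G\<^esub> y)"
    using assms(2) unfolding bdd_cohomologous2_def by blast
  show ?thesis unfolding bdd_cohomologous2_def
  proof (intro exI conjI ballI)
    fix x assume x: "x \<in> carrier G"
    show "\<bar>\<beta> x + \<gamma> x\<bar> \<le> B + C" using 1(1)[OF x] 2(1)[OF x] by linarith
    fix y assume "y \<in> carrier G"
    then show "c x y = e x y + (\<beta> x + \<gamma> x) + (\<beta> y + \<gamma> y) - (\<beta> (x \<otimes>\<^bsub>G\<^esub> y) + \<gamma> (x \<otimes>\<^bsub>G\<^esub> y))"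
      using 1(2) 2(2) x by simp
  qed
qed

lemma bdd_cohomologous2_add:
  assumes "bdd_cohomologous2 G c d" "bdd_cohomologous2 G c' d'"
  shows "bdd_cohomologous2 G (\<lambda>x y. c x y + c' x y) (\<lambda>x y. d x y + d' x y)"
proof -
  obtain \<beta> B where 1: "\<And>x. x \<in> carrier G \<Longrightarrow> \<bar>\<beta> x\<bar> \<le> B"
      "\<And>x y. x \<in> carrier G \<Longrightarrow> y \<in> carrier G \<Longrightarrow> c x y = d x y + \<beta> x + \<beta> y - \<beta> (x \<otimes>\<^bsub>G\<^esub> y)"
    using assms(1) unfolding bdd_cohomologous2_def by blast
  obtain \<gamma> C where 2: "\<And>x. x \<in> carrier G \<Longrightarrow> \<bar>\<gamma> x\<bar> \<le> C"
      "\<And>x y. x \<in> carrier G \<Longrightarrow> y \<in> carrier G \<Longrightarrow> c' x y = d' x y + \<gamma> x + \<gamma> y - \<gamma> (x \<otimes>\<^bsub>G\<^esub> y)"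
    using assms(2) unfolding bdd_cohomologous2_def by blast
  show ?thesis unfolding bdd_cohomologous2_def
  proof (intro exI conjI ballI)
    fix x assume x: "x \<in> carrier G"
    show "\<bar>\<beta> x + \<gamma> x\<bar> \<le> B + C" using 1(1)[OF x] 2(1)[OF x] by linarith
    fix y assume "y \<in> carrier G"
    then show "c x y + c' x y = d x y + d' x y + (\<beta> x + \<gamma> x) + (\<beta> y + \<gamma> y)
        - (\<beta> (x \<otimes>\<^bsub>G\<^esub> y) + \<gamma> (x \<otimes>\<^bsub>G\<^esub> y))"
      using 1(2) 2(2) x by simp
  qed
qed

lemma bdd_cohomologous2_refl: "bdd_cohomologous2 G c c"
  unfolding bdd_cohomologous2_def by (intro exI[of _ "\<lambda>_. 0"] exI[of _ 0]) simp

lemma bdd_cohomologous2_scale: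
  assumes "bdd_cohomologous2 G c d"
  shows "bdd_cohomologous2 G (\<lambda>x y. a * c x y) (\<lambda>x y. a * d x y)"
proof -
  obtain \<beta> B where "\<And>x. x \<in> carrier G \<Longrightarrow> \<bar>\<beta> x\<bar> \<le> B"
      "\<And>x y. x \<in> carrier G \<Longrightarrow> y \<in> carrier G \<Longrightarrow> c x y = d x y + \<beta> x + \<beta> y - \<beta> (x \<otimes>\<^bsub>G\<^esub> y)"
    using assms unfolding bdd_cohomologous2_def by blast
  then show ?thesis unfolding bdd_cohomologous2_def
    by (intro exI[of _ "\<lambda>x. a * \<beta> x"] exI[of _ "\<bar>a\<bar> * B"])
      (simp add: abs_mult mult_left_mono distrib_left right_diff_distrib)
qed

lemma bdd_cohomologous2_sym:
  assumes "bdd_cohomologous2 G c d"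
  shows "bdd_cohomologous2 G d c"
proof -
  obtain \<beta> B where "\<And>x. x \<in> carrier G \<Longrightarrow> \<bar>\<beta> x\<bar> \<le> B"
      "\<And>x y. x \<in> carrier G \<Longrightarrow> y \<in> carrier G \<Longrightarrow> c x y = d x y + \<beta> x + \<beta> y - \<beta> (x \<otimes>\<^bsub>G\<^esub> y)"
    using assms unfolding bdd_cohomologous2_def by blast
  then show ?thesis unfolding bdd_cohomologous2_def
    by (intro exI[of _ "\<lambda>x. - \<beta> x"] exI[of _ B]) simp
qed

text \<open>The identity \<open>cocycle\<close> is associativity of the central extension of
  \<open>G\<close> by the reals with product
  \<open>(a, x) (b, y) = (a + b + c x y, x \<otimes> y)\<close>. The explicit \<open>K\<close>
  serves to bound the correcting 1-cochains built from values of \<open>c\<close>.\<close>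

locale bounded_cocycle2 = group G for G (structure) +
  fixes c :: "'a \<Rightarrow> 'a \<Rightarrow> real" and K :: real
  assumes cocycle: "\<lbrakk>x \<in> carrier G; y \<in> carrier G; z \<in> carrier G\<rbrakk> \<Longrightarrow>
      c x y + c (x \<otimes> y) z = c y z + c x (y \<otimes> z)"
    and bounded: "\<lbrakk>x \<in> carrier G; y \<in> carrier G\<rbrakk> \<Longrightarrow> \<bar>c x y\<bar> \<le> K"
begin

text \<open>
  The difference \<open>c x y - c y x\<close> is the commutator of lifts to the central extension defined
  by \<open>c\<close>; it is additive on the centralizer of \<open>x\<close> and bounded, hence zero.
\<close>

lemma cocycle_symmetric:
  assumes x: "x \<in> carrier G" and y: "y \<in> carrier G" and xy: "x \<otimes> y = y \<otimes> x"
  shows "c x y = c y x"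
proof -
  define s where "s z = c x z - c z x" for z
  have commute_pow: "x \<otimes> y [^] n = y [^] n \<otimes> x" for n :: nat
    by (metis group_commutes_pow x xy y)
  have add: "s (y [^] n \<otimes> y) = s (y [^] n) + s y" for n :: nat
  proof -
    let ?z = "y [^] n"
    have z: "?z \<in> carrier G" using y by simp
    show ?thesis
      \<comment> \<open>The three triples are the ways to insert \<open>x\<close> into the pair
        \<open>?z\<close>, \<open>y\<close>. In the signed sum \<open>c ?z y\<close> cancels, and
        the remaining mixed terms cancel because \<open>x\<close> commutes with \<open>?z\<close>
        and with \<open>y\<close>.\<close>
      using cocycle[OF x z y] cocycle[OF z y x] cocycle[OF z x y] commute_pow[of n] xy
      unfolding s_def by simp
  qed
  \<comment> \<open>Both sides equal \<open>c \<one> \<one>\<close>; this is the base case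
    \<open>s \<one> = 0\<close> of the induction.\<close>
  have "c x \<one> = c \<one> x"
    using cocycle[OF x one_closed one_closed] cocycle[OF one_closed one_closed x] 
      cocycle[OF one_closed x one_closed] x by simp
  then have mult: "s (y [^] n) = real n * s y" for n
    by (induction n) (simp_all add: add algebra_simps, simp add: s_def)
  have "real n * \<bar>s y\<bar> \<le> 2 * K" for n
  proof -
    have "\<bar>s (y [^] n)\<bar> \<le> 2 * K"
      using bounded[of x "y [^] n"] bounded[of "y [^] n" x] x y unfolding s_def by simp
    then show ?thesis by (simp add: mult abs_mult)
  qed
  then have "s y = 0"
    by (metis abs_le_zero_iff not_less reals_Archimedean3)
  then show ?thesis by (simp add: s_def)
qed

text \<open>In the central extension the lifts of \<open>q\<close> and \<open>r\<close> commute by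
  \<open>cocycle_symmetric\<close>. Hence multiplying the lifts of \<open>p, r, q, s\<close> as
  \<open>(p r) (q s)\<close> and as \<open>(p q) (r s)\<close> gives the same element, and the two
  sides are its central coordinates.\<close>

lemma cocycle_commuting_product:
  assumes carr: "p \<in> carrier G" "q \<in> carrier G" "r \<in> carrier G" "s \<in> carrier G"
    and qr: "q \<otimes> r = r \<otimes> q"
  shows "c (p \<otimes> r) (q \<otimes> s) + c p r + c q s = c p q + c r s + c (p \<otimes> q) (r \<otimes> s)"
proof -
  have "r \<otimes> (q \<otimes> s) = q \<otimes> (r \<otimes> s)" using carr qr by (simp flip: m_assoc)
  then show ?thesis
    using cocycle[of p r "q \<otimes> s"] cocycle[of p q "r \<otimes> s"] cocycle[of r q s] cocycle[of q r s]
      cocycle_symmetric[of q r] carr qr by simp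
qed

text \<open>
  Conjugation by a lift of \<open>w\<close> maps the lift of \<open>x\<close> to that of \<open>x'\<close> shifted by \<open>c w x - c x' w\<close>.
\<close>

lemma cocycle_conjugate:
  assumes carr: "w \<in> carrier G" "x \<in> carrier G" "y \<in> carrier G" "x' \<in> carrier G" "y' \<in> carrier G"
    and x': "x' \<otimes> w = w \<otimes> x" and y': "y' \<otimes> w = w \<otimes> y"
  shows "c x' y' = c x y - (c w x - c x' w) - (c w y - c y' w)
           + (c w (x \<otimes> y) - c (x' \<otimes> y') w)"
  \<comment> \<open>The three identities follow \<open>w\<close> through the chain
    \<open>x' y' w = x' w y = w x y\<close>.\<close>
  using cocycle[of x' y' w] cocycle[of x' w y] cocycle[of w x y] carr x' y' by simp

end

section \<open>Homogeneous and inhomogeneous cocycles\<close>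

lemma map_hom_tuples:
  assumes "xs \<in> tuples H n" "\<theta> \<in> hom H G"
  shows "map \<theta> xs \<in> tuples G n"
  using assms by (auto simp: tuples_def hom_in_carrier)

lemma sup_norm_upper:
  assumes "f \<in> bdd_cochains G n" "xs \<in> tuples G n"
  shows "\<bar>f xs\<bar> \<le> sup_norm G n f"
  unfolding sup_norm_def using assms by (intro cSUP_upper) (auto simp: bdd_cochains_def)

lemma face_tuples:
  assumes "xs \<in> tuples G (n + 1)" "i \<le> n + 1"
  shows "take i xs @ drop (i + 1) xs \<in> tuples G n"
  using assms set_take_subset[of i xs] set_drop_subset[of "i + 1" xs] by (auto simp: tuples_def)

lemma bdd_cochainsI:
  assumes "\<And>xs. xs \<notin> tuples G n \<Longrightarrow> f xs = 0"
    and "\<And>g xs. g \<in> carrier G \<Longrightarrow> xs \<in> tuples G n \<Longrightarrow> f (map (\<lambda>x. g \<otimes>\<^bsub>G\<^esub> x) xs) = f xs"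
    and "\<And>xs. xs \<in> tuples G n \<Longrightarrow> \<bar>f xs\<bar> \<le> B"
  shows "f \<in> bdd_cochains G n"
  unfolding bdd_cochains_def using assms by (auto intro!: bdd_aboveI2[of _ _ B])

text \<open>Applying \<open>\<theta>\<close> entrywise turns left translation by \<open>g\<close>
  into left translation by \<open>\<theta> g\<close> and commutes with omitting an entry.\<close>

lemma pullback_bdd_cocycle:
  assumes "group H" "group G" and \<theta>: "\<theta> \<in> hom H G" and f: "f \<in> bdd_cocycles G n"
  shows "pullback H n \<theta> f \<in> bdd_cocycles H n"
proof -
  interpret H: group H by fact
  have f_cochain: "f \<in> bdd_cochains G n" and df: "coboundary G n f = (\<lambda>_. 0)"
    using f by (auto simp: bdd_cocycles_def)
  have "pullback H n \<theta> f \<in> bdd_cochains H n"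
  proof (rule bdd_cochainsI)
    fix xs assume "xs \<notin> tuples H n"
    then show "pullback H n \<theta> f xs = 0" by (simp add: pullback_def)
  next
    fix g xs assume g: "g \<in> carrier H" and xs: "xs \<in> tuples H n"
    have "map (\<lambda>x. g \<otimes>\<^bsub>H\<^esub> x) xs \<in> tuples H n" using g xs by (auto simp: tuples_def)
    moreover have "map (\<theta> \<circ> (\<lambda>x. g \<otimes>\<^bsub>H\<^esub> x)) xs = map (\<lambda>x. \<theta> g \<otimes>\<^bsub>G\<^esub> x) (map \<theta> xs)"
      using g xs hom_mult[OF \<theta>] by (auto simp: tuples_def)
    moreover have "f (map (\<lambda>x. \<theta> g \<otimes>\<^bsub>G\<^esub> x) (map \<theta> xs)) = f (map \<theta> xs)"
      using f_cochain hom_in_carrier[OF \<theta> g] map_hom_tuples[OF xs \<theta>]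
      unfolding bdd_cochains_def by blast
    ultimately show "pullback H n \<theta> f (map (\<lambda>x. g \<otimes>\<^bsub>H\<^esub> x) xs) = pullback H n \<theta> f xs"
      using xs by (simp add: pullback_def del: map_map flip: map_map)
  next
    fix xs assume "xs \<in> tuples H n"
    then show "\<bar>pullback H n \<theta> f xs\<bar> \<le> sup_norm G n f"
      using sup_norm_upper[OF f_cochain map_hom_tuples[OF _ \<theta>]] by (simp add: pullback_def)
  qed
  moreover have "coboundary H n (pullback H n \<theta> f) xs = 0" for xs
  proof (cases "xs \<in> tuples H (n + 1)")
    case True
    have "coboundary H n (pullback H n \<theta> f) xs = coboundary G n f (map \<theta> xs)"
      using map_hom_tuples[OF True \<theta>] True face_tuples[OF True]
      by (auto simp: coboundary_def pullback_def take_map drop_map intro!: sum.cong)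
    then show ?thesis by (simp add: df)
  qed (simp add: coboundary_def)
  ultimately show ?thesis by (auto simp: bdd_cocycles_def)
qed

lemma bdd_cocycles_scale:
  assumes f: "f \<in> bdd_cocycles G n"
  shows "(\<lambda>xs. a * f xs) \<in> bdd_cocycles G n"
proof -
  have f_cochain: "f \<in> bdd_cochains G n" and df: "coboundary G n f = (\<lambda>_. 0)"
    using f by (auto simp: bdd_cocycles_def)
  have "(\<lambda>xs. a * f xs) \<in> bdd_cochains G n"
    by (rule bdd_cochainsI[where B = "\<bar>a\<bar> * sup_norm G n f"])
      (use f_cochain sup_norm_upper[OF f_cochain] in
        \<open>auto simp: bdd_cochains_def abs_mult mult_left_mono\<close>)
  moreover have "coboundary G n (\<lambda>xs. a * f xs) = (\<lambda>xs. a * coboundary G n f xs)"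
    by (rule ext) (simp add: coboundary_def sum_distrib_left mult.left_commute del: sum.atMost_Suc)
  ultimately show ?thesis by (simp add: bdd_cocycles_def df)
qed

context group
begin

lemma cancel_left:
  assumes "x \<in> carrier G" "y \<in> carrier G"
  shows "inv x \<otimes> (x \<otimes> y) = y" "x \<otimes> (inv x \<otimes> y) = y"
  using assms by (simp_all flip: m_assoc)

lemma tuples_nonempty: "tuples G n \<noteq> {}"
proof -
  have "replicate (n + 1) \<one> \<in> tuples G n" by (auto simp: tuples_def)
  then show ?thesis by blast
qed

lemma sup_norm_nonneg:
  assumes "f \<in> bdd_cochains G n"
  shows "0 \<le> sup_norm G n f"
proof -
  obtain xs where "xs \<in> tuples G n" using tuples_nonempty by blast
  from sup_norm_upper[OF assms this] show ?thesis by linarith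
qed

text \<open>Invariance under \<open>inv x\<close> moves the first entry to \<open>\<one>\<close>.
  The last entry is left as a product so that the right side has the bar form
  \<open>f [\<one>, u, u \<otimes> v]\<close> with \<open>u = inv x \<otimes> y\<close> and
  \<open>v = inv y \<otimes> z\<close>.\<close>

lemma cochain2_inhomogeneous:
  assumes f: "f \<in> bdd_cochains G 2" and carr: "x \<in> carrier G" "y \<in> carrier G" "z \<in> carrier G"
  shows "f [x, y, z] = f [\<one>, inv x \<otimes> y, (inv x \<otimes> y) \<otimes> (inv y \<otimes> z)]"
proof -
  have "[x, y, z] \<in> tuples G 2" using carr by (simp add: tuples_def)
  then have "f (map (\<lambda>u. inv x \<otimes> u) [x, y, z]) = f [x, y, z]"
    using f inv_closed[OF carr(1)] unfolding bdd_cochains_def by blast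
  then show ?thesis using carr by (simp add: m_assoc cancel_left)
qed

lemma bounded_cocycle2_of_bdd_cocycle:
  assumes f: "f \<in> bdd_cocycles G 2"
  shows "bounded_cocycle2 G (\<lambda>x y. f [\<one>, x, x \<otimes> y]) (sup_norm G 2 f)"
proof
  have f_cochain: "f \<in> bdd_cochains G 2" and df: "coboundary G 2 f = (\<lambda>_. 0)"
    using f by (auto simp: bdd_cocycles_def)
  fix x y assume x: "x \<in> carrier G" and y: "y \<in> carrier G"
  show "\<bar>f [\<one>, x, x \<otimes> y]\<bar> \<le> sup_norm G 2 f"
    using x y by (intro sup_norm_upper f_cochain) (simp add: tuples_def)
  fix z assume z: "z \<in> carrier G"
  \<comment> \<open>The tuple with successive quotients \<open>x\<close>, \<open>y\<close>,
    \<open>z\<close>: the homogeneous cocycle condition on it is the bar identity for these three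
    elements.\<close>
  let ?xs = "[\<one>, x, x \<otimes> y, x \<otimes> y \<otimes> z]"
  have "coboundary G 2 f ?xs = 0" by (simp add: df)
  moreover have "?xs \<in> tuples G (2 + 1)" using x y z by (simp add: tuples_def)
  ultimately have "f [x, x \<otimes> y, x \<otimes> y \<otimes> z] - f [\<one>, x \<otimes> y, x \<otimes> y \<otimes> z]
      + f [\<one>, x, x \<otimes> y \<otimes> z] - f [\<one>, x, x \<otimes> y] = 0"
    by (simp add: coboundary_def eval_nat_numeral)
  \<comment> \<open>Only the face omitting \<open>\<one>\<close> has to be translated back to a
    tuple that starts with \<open>\<one>\<close>.\<close>
  moreover have "f [x, x \<otimes> y, x \<otimes> y \<otimes> z] = f [\<one>, y, y \<otimes> z]"
    using cochain2_inhomogeneous[OF f_cochain, of x "x \<otimes> y" "x \<otimes> y \<otimes> z"] x y z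
    by (simp add: m_assoc cancel_left inv_mult_group)
  ultimately show "f [\<one>, x, x \<otimes> y] + f [\<one>, x \<otimes> y, x \<otimes> y \<otimes> z]
      = f [\<one>, y, y \<otimes> z] + f [\<one>, x, x \<otimes> (y \<otimes> z)]"
    using x y z by (simp add: m_assoc)
qed

text \<open>Homogenization: the invariant 1-cochain with value
  \<open>\<beta> (inv x \<otimes> y)\<close> at \<open>[x, y]\<close> is bounded along with
  \<open>\<beta>\<close>, and its coboundary is \<open>f - g\<close>. This carries comparisons made
  in the bar complex back to \<open>Hb\<close>.\<close>

lemma bdd_cohomologous2_imp_cohomologous:
  assumes f: "f \<in> bdd_cocycles G 2" and g: "g \<in> bdd_cocycles G 2"
    and fg: "bdd_cohomologous2 G (\<lambda>x y. f [\<one>, x, x \<otimes> y]) (\<lambda>x y. g [\<one>, x, x \<otimes> y])"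
  shows "(f, g) \<in> cohomologous G 2"
proof -
  have f_cochain: "f \<in> bdd_cochains G 2" and g_cochain: "g \<in> bdd_cochains G 2"
    using f g by (auto simp: bdd_cocycles_def)
  obtain \<beta> B where \<beta>: "\<And>x. x \<in> carrier G \<Longrightarrow> \<bar>\<beta> x\<bar> \<le> B"
      "\<And>x y. x \<in> carrier G \<Longrightarrow> y \<in> carrier G \<Longrightarrow>
        f [\<one>, x, x \<otimes> y] = g [\<one>, x, x \<otimes> y] + \<beta> x + \<beta> y - \<beta> (x \<otimes> y)"
    using fg unfolding bdd_cohomologous2_def by blast
  define b where "b xs = (if xs \<in> tuples G 1 then \<beta> (inv (xs ! 0) \<otimes> xs ! 1) else 0)" for xs
  have tuples1: "\<exists>x y. xs = [x, y] \<and> x \<in> carrier G \<and> y \<in> carrier G" if "xs \<in> tuples G 1" for xs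
    using that by (auto simp: tuples_def length_Suc_conv)
  have b_eq: "b [x, y] = \<beta> (inv x \<otimes> y)" if "x \<in> carrier G" "y \<in> carrier G" for x y
    using that by (simp add: b_def tuples_def)
  have "b \<in> bdd_cochains G 1"
  proof (rule bdd_cochainsI)
    fix xs assume "xs \<notin> tuples G 1"
    then show "b xs = 0" by (simp add: b_def)
  next
    fix u xs assume u: "u \<in> carrier G" and "xs \<in> tuples G 1"
    then obtain x y where xs: "xs = [x, y]" "x \<in> carrier G" "y \<in> carrier G" using tuples1 by blast
    have "inv (u \<otimes> x) \<otimes> (u \<otimes> y) = inv x \<otimes> y"
      using u xs by (simp add: inv_mult_group m_assoc cancel_left)
    then show "b (map (\<lambda>x. u \<otimes> x) xs) = b xs" using u xs by (simp add: b_eq)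
  next
    fix xs assume "xs \<in> tuples G 1"
    then show "\<bar>b xs\<bar> \<le> B" using tuples1[of xs] by (auto simp: b_eq intro!: \<beta>(1))
  qed
  moreover have "(\<lambda>xs. f xs - g xs) = coboundary G 1 b"
  proof
    fix xs show "f xs - g xs = coboundary G 1 b xs"
    proof (cases "xs \<in> tuples G 2")
      \<comment> \<open>Outside the tuples both sides vanish by the convention built into cochains
        and \<open>coboundary\<close>.\<close>
      case False
      then show ?thesis
        using f_cochain g_cochain by (simp add: bdd_cochains_def coboundary_def numeral_2_eq_2)
    next
      case True
      then obtain x y z where xs: "xs = [x, y, z]"
        and carr: "x \<in> carrier G" "y \<in> carrier G" "z \<in> carrier G"
        by (auto simp: tuples_def length_Suc_conv eval_nat_numeral)
      \<comment> \<open>With \<open>u = inv x \<otimes> y\<close> and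
        \<open>v = inv y \<otimes> z\<close>, the terms \<open>\<beta> u\<close>,
        \<open>\<beta> v\<close>, \<open>\<beta> (u \<otimes> v)\<close> become
        \<open>b [x, y]\<close>, \<open>b [y, z]\<close>, \<open>b [x, z]\<close>.\<close>
      have "(inv x \<otimes> y) \<otimes> (inv y \<otimes> z) = inv x \<otimes> z"
        using carr by (simp add: m_assoc cancel_left)
      moreover have "coboundary G 1 b xs = b [y, z] - b [x, z] + b [x, y]"
        using True xs by (simp add: coboundary_def eval_nat_numeral)
      ultimately show ?thesis
        using cochain2_inhomogeneous[OF f_cochain carr] cochain2_inhomogeneous[OF g_cochain carr]
          \<beta>(2)[of "inv x \<otimes> y" "inv y \<otimes> z"] carr xs
        by (simp add: b_eq)
    qed
  qed
  ultimately show ?thesis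
    using f g by (auto simp: cohomologous_def bdd_coboundaries_def numeral_2_eq_2)
qed

end

section \<open>Products of commuting homomorphisms\<close>

primrec pointwise_prod ::
  "('k, 'm) monoid_scheme \<Rightarrow> (nat \<Rightarrow> 'g \<Rightarrow> 'k) \<Rightarrow> nat \<Rightarrow> 'g \<Rightarrow> 'k" where
  "pointwise_prod G \<phi> 0 x = \<one>\<^bsub>G\<^esub>"
| "pointwise_prod G \<phi> (Suc n) x = pointwise_prod G \<phi> n x \<otimes>\<^bsub>G\<^esub> \<phi> n x"

text \<open>Commutation is asked only for \<open>i \<noteq> j\<close>, so that each single image may
  be nonabelian, as the symplectic blocks are.\<close>

locale commuting_homs = G: group G + H: group H
  for G (structure) and H (structure) +
  fixes \<phi> :: "nat \<Rightarrow> 'b \<Rightarrow> 'a" and m :: nat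
  assumes hom: "i < m \<Longrightarrow> \<phi> i \<in> hom H G"
    and commute: "\<lbrakk>i < m; j < m; i \<noteq> j; x \<in> carrier H; y \<in> carrier H\<rbrakk> \<Longrightarrow>
      \<phi> i x \<otimes>\<^bsub>G\<^esub> \<phi> j y = \<phi> j y \<otimes>\<^bsub>G\<^esub> \<phi> i x"
begin

lemma closed: "i < m \<Longrightarrow> x \<in> carrier H \<Longrightarrow> \<phi> i x \<in> carrier G"
  using hom by (rule hom_in_carrier)

abbreviation prod_hom :: "nat \<Rightarrow> 'b \<Rightarrow> 'a" where
  "prod_hom \<equiv> pointwise_prod G \<phi>"

lemma prod_hom_closed: "n \<le> m \<Longrightarrow> x \<in> carrier H \<Longrightarrow> prod_hom n x \<in> carrier G"
  by (induction n) (auto simp: closed)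

lemma prod_hom_commute:
  assumes "n \<le> j" "j < m" "x \<in> carrier H" "y \<in> carrier H"
  shows "prod_hom n x \<otimes>\<^bsub>G\<^esub> \<phi> j y = \<phi> j y \<otimes>\<^bsub>G\<^esub> prod_hom n x"
  using assms
proof (induction n)
  case 0
  then show ?case by (simp add: closed)
next
  case (Suc n)
  let ?p = "prod_hom n x" and ?r = "\<phi> n x" and ?q = "\<phi> j y"
  have carr: "?p \<in> carrier G" "?r \<in> carrier G" "?q \<in> carrier G"
    using Suc.prems by (auto intro!: closed prod_hom_closed)
  have pq: "?p \<otimes>\<^bsub>G\<^esub> ?q = ?q \<otimes>\<^bsub>G\<^esub> ?p" using Suc by simp
  have rq: "?r \<otimes>\<^bsub>G\<^esub> ?q = ?q \<otimes>\<^bsub>G\<^esub> ?r" using Suc.prems by (intro commute) auto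
  have "?p \<otimes>\<^bsub>G\<^esub> ?r \<otimes>\<^bsub>G\<^esub> ?q = ?p \<otimes>\<^bsub>G\<^esub> (?q \<otimes>\<^bsub>G\<^esub> ?r)"
    by (simp add: G.m_assoc carr rq)
  also have "\<dots> = ?q \<otimes>\<^bsub>G\<^esub> ?p \<otimes>\<^bsub>G\<^esub> ?r" by (simp add: carr pq flip: G.m_assoc)
  finally show ?case by (simp add: carr G.m_assoc)
qed

text \<open>In the inductive step \<open>prod_hom n y\<close> has to pass \<open>\<phi> n x\<close>,
  which is where commuting images enter.\<close>

lemma prod_hom_mult:
  assumes "n \<le> m" "x \<in> carrier H" "y \<in> carrier H"
  shows "prod_hom n (x \<otimes>\<^bsub>H\<^esub> y) = prod_hom n x \<otimes>\<^bsub>G\<^esub> prod_hom n y"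
  using assms
proof (induction n)
  case 0
  then show ?case by simp
next
  case (Suc n)
  let ?p = "prod_hom n x" and ?r = "\<phi> n x" and ?q = "prod_hom n y" and ?s = "\<phi> n y"
  have carr: "?p \<in> carrier G" "?r \<in> carrier G" "?q \<in> carrier G" "?s \<in> carrier G"
    using Suc.prems by (auto intro!: closed prod_hom_closed)
  have "?q \<otimes>\<^bsub>G\<^esub> ?r = ?r \<otimes>\<^bsub>G\<^esub> ?q" using Suc.prems by (intro prod_hom_commute) auto
  then have "?q \<otimes>\<^bsub>G\<^esub> (?r \<otimes>\<^bsub>G\<^esub> ?s) = ?r \<otimes>\<^bsub>G\<^esub> (?q \<otimes>\<^bsub>G\<^esub> ?s)"
    by (simp add: carr flip: G.m_assoc)
  moreover have "\<phi> n (x \<otimes>\<^bsub>H\<^esub> y) = ?r \<otimes>\<^bsub>G\<^esub> ?s"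
    using Suc.prems hom by (intro hom_mult) auto
  ultimately show ?case using Suc by (simp add: carr G.m_assoc)
qed

text \<open>Additivity of degree 2 classes on commuting homomorphisms, by splitting off one factor
  at a time with \<open>cocycle_commuting_product\<close>.\<close>

lemma prod_hom_pullback:
  assumes "bounded_cocycle2 G c K" and "n \<le> m"
  shows "bdd_cohomologous2 H (\<lambda>x y. c (prod_hom n x) (prod_hom n y))
           (\<lambda>x y. \<Sum>i<n. c (\<phi> i x) (\<phi> i y))"
  using \<open>n \<le> m\<close>
proof (induction n)
  case 0
  \<comment> \<open>For the empty product the pullback is the constant
    \<open>c \<one> \<one>\<close>, which is the coboundary of the 1-cochain with that same constant
    value.\<close>
  show ?case unfolding bdd_cohomologous2_def
    by (intro exI[of _ "\<lambda>_. c \<one>\<^bsub>G\<^esub> \<one>\<^bsub>G\<^esub>"] exI[of _ "\<bar>c \<one>\<^bsub>G\<^esub> \<one>\<^bsub>G\<^esub>\<bar>"]) simp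
next
  case (Suc n)
  interpret c: bounded_cocycle2 G c K by fact
  have carr: "prod_hom n x \<in> carrier G" "\<phi> n x \<in> carrier G" if "x \<in> carrier H" for x
    using Suc.prems that by (auto intro!: closed prod_hom_closed)
  have step: "bdd_cohomologous2 H (\<lambda>x y. c (prod_hom (Suc n) x) (prod_hom (Suc n) y))
      (\<lambda>x y. c (prod_hom n x) (prod_hom n y) + c (\<phi> n x) (\<phi> n y))"
    unfolding bdd_cohomologous2_def
  proof (intro exI conjI ballI)
    fix x assume x: "x \<in> carrier H"
    \<comment> \<open>The correcting cochain is the central coordinate lost when the lifts of the
      two commuting factors at \<open>x\<close> are multiplied.\<close>
    show "\<bar>- c (prod_hom n x) (\<phi> n x)\<bar> \<le> K" using c.bounded carr[OF x] by simp
    fix y assume y: "y \<in> carrier H"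
    have "\<phi> n (x \<otimes>\<^bsub>H\<^esub> y) = \<phi> n x \<otimes>\<^bsub>G\<^esub> \<phi> n y"
      using Suc.prems hom x y by (intro hom_mult) auto
    moreover have "prod_hom n y \<otimes>\<^bsub>G\<^esub> \<phi> n x = \<phi> n x \<otimes>\<^bsub>G\<^esub> prod_hom n y"
      using Suc.prems x y by (intro prod_hom_commute) auto
    ultimately show "c (prod_hom (Suc n) x) (prod_hom (Suc n) y) =
        c (prod_hom n x) (prod_hom n y) + c (\<phi> n x) (\<phi> n y)
        + - c (prod_hom n x) (\<phi> n x) + - c (prod_hom n y) (\<phi> n y)
        - - c (prod_hom n (x \<otimes>\<^bsub>H\<^esub> y)) (\<phi> n (x \<otimes>\<^bsub>H\<^esub> y))"
      using c.cocycle_commuting_product[of "prod_hom n x" "prod_hom n y" "\<phi> n x" "\<phi> n y"]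
        carr[OF x] carr[OF y] prod_hom_mult[of n x y] Suc.prems x y by simp
  qed
  show ?case
    using bdd_cohomologous2_trans[OF step bdd_cohomologous2_add[OF Suc.IH bdd_cohomologous2_refl]]
      Suc.prems by simp
qed

end

section \<open>Conjugate commuting homomorphisms and the norm estimate\<close>

locale conjugate_commuting_homs = commuting_homs G H \<phi> m
  for G (structure) and H (structure) and \<phi> m +
  fixes \<psi> w
  assumes psi_hom: "\<psi> \<in> hom H G"
    and w_closed: "i < m \<Longrightarrow> w i \<in> carrier G"
    and conjugate: "\<lbrakk>i < m; x \<in> carrier H\<rbrakk> \<Longrightarrow> \<phi> i x \<otimes>\<^bsub>G\<^esub> w i = w i \<otimes>\<^bsub>G\<^esub> \<psi> x"
begin

text \<open>Inner automorphisms act trivially on bounded cohomology. The shift of lifts in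
  \<open>cocycle_conjugate\<close> supplies the correcting cochain; it is a difference of two values
  of \<open>c\<close>, hence the bound \<open>2 * K\<close>.\<close>

lemma conjugate_pullback:
  assumes "bounded_cocycle2 G c K" and i: "i < m"
  shows "bdd_cohomologous2 H (\<lambda>x y. c (\<phi> i x) (\<phi> i y)) (\<lambda>x y. c (\<psi> x) (\<psi> y))"
  unfolding bdd_cohomologous2_def
proof (intro exI conjI ballI)
  interpret c: bounded_cocycle2 G c K by fact
  note carr = closed[OF i] hom_in_carrier[OF psi_hom] w_closed[OF i]
  fix x assume x: "x \<in> carrier H"
  show "\<bar>c (\<phi> i x) (w i) - c (w i) (\<psi> x)\<bar> \<le> 2 * K"
    using c.bounded[of "\<phi> i x" "w i"] c.bounded[of "w i" "\<psi> x"] carr x i by simp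
  fix y assume y: "y \<in> carrier H"
  show "c (\<phi> i x) (\<phi> i y) = c (\<psi> x) (\<psi> y)
      + (c (\<phi> i x) (w i) - c (w i) (\<psi> x)) + (c (\<phi> i y) (w i) - c (w i) (\<psi> y))
      - (c (\<phi> i (x \<otimes>\<^bsub>H\<^esub> y)) (w i) - c (w i) (\<psi> (x \<otimes>\<^bsub>H\<^esub> y)))"
    using c.cocycle_conjugate[of "w i" "\<psi> x" "\<psi> y" "\<phi> i x" "\<phi> i y"] carr x y i
      conjugate[OF i] hom_mult[OF hom[OF i] x y] hom_mult[OF psi_hom x y]
    by simp
qed

lemma prod_hom_pullback_multiple:
  assumes "bounded_cocycle2 G c K"
  shows "bdd_cohomologous2 H (\<lambda>x y. c (prod_hom m x) (prod_hom m y))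
           (\<lambda>x y. real m * c (\<psi> x) (\<psi> y))"
proof -
  have "bdd_cohomologous2 H (\<lambda>x y. \<Sum>i<n. c (\<phi> i x) (\<phi> i y)) (\<lambda>x y. real n * c (\<psi> x) (\<psi> y))"
    if "n \<le> m" for n
    using that
  proof (induction n)
    case 0
    show ?case by (simp add: bdd_cohomologous2_refl)
  next
    case (Suc n)
    then show ?case
      using bdd_cohomologous2_add[OF Suc.IH conjugate_pullback[OF assms, of n]]
      by (simp add: algebra_simps)
  qed
  then show ?thesis
    using prod_hom_pullback[OF assms order_refl] bdd_cohomologous2_trans by blast
qed


lemma prod_hom_hom: "prod_hom m \<in> hom H G"
  by (intro homI prod_hom_closed prod_hom_mult order_refl)

text \<open>For each \<open>f\<close> in \<open>C\<close>, the cocycle \<open>1 / m\<close> times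
  the pullback of \<open>f\<close> along the product represents the pulled back class of
  \<open>\<psi>\<close>. Its sup norm is at most that of \<open>f\<close> divided by
  \<open>m\<close>; the infimum over \<open>f\<close> gives the estimate.\<close>

lemma Hb_norm_pullback_le:
  assumes m: "m > 0" and C: "C \<in> Hb G 2"
  shows "Hb_norm H 2 (Hb_map H 2 \<psi> C) \<le> 1 / real m * Hb_norm G 2 C"
proof -
  let ?\<Phi> = "prod_hom m"
  have C_cocycles: "C \<subseteq> bdd_cocycles G 2"
    using C by (auto simp: Hb_def quotient_def cohomologous_def)
  \<comment> \<open>The infimum defining \<open>Hb_norm G 2 C\<close> can be bounded from below
    elementwise only over a nonempty set.\<close>
  have C_nonempty: "C \<noteq> {}"
  proof -
    obtain f where f: "f \<in> bdd_cocycles G 2" "C = cohomologous G 2 `` {f}"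
      using C by (auto simp: Hb_def quotient_def)
    have "(f, f) \<in> cohomologous G 2"
      using f(1) by (intro G.bdd_cohomologous2_imp_cohomologous bdd_cohomologous2_refl)
    then show ?thesis using f(2) by auto
  qed
  have "Hb_norm H 2 (Hb_map H 2 \<psi> C) \<le> sup_norm G 2 f / real m" if f: "f \<in> C" for f
  proof -
    let ?g = "\<lambda>xs. 1 / real m * pullback H 2 ?\<Phi> f xs"
    have f_cocycle: "f \<in> bdd_cocycles G 2" using f C_cocycles by blast
    define c where "c x y = f [\<one>\<^bsub>G\<^esub>, x, x \<otimes>\<^bsub>G\<^esub> y]" for x y
    have "bounded_cocycle2 G c (sup_norm G 2 f)"
      unfolding c_def by (rule G.bounded_cocycle2_of_bdd_cocycle[OF f_cocycle])
    from bdd_cohomologous2_scale[OF bdd_cohomologous2_sym[OF prod_hom_pullback_multiple[OF this]],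
        of "1 / real m"] m
    have "bdd_cohomologous2 H (\<lambda>x y. c (\<psi> x) (\<psi> y)) (\<lambda>x y. 1 / real m * c (?\<Phi> x) (?\<Phi> y))"
      by simp
    \<comment> \<open>Passing to bar form commutes with pullback; it is applied below to both
      \<open>\<psi>\<close> and \<open>?\<Phi>\<close>.\<close>
    moreover have "pullback H 2 \<theta> f [\<one>\<^bsub>H\<^esub>, x, x \<otimes>\<^bsub>H\<^esub> y] = c (\<theta> x) (\<theta> y)"
      if "\<theta> \<in> hom H G" "x \<in> carrier H" "y \<in> carrier H" for \<theta> x y
      using that hom_one[OF that(1) H.is_group G.is_group] hom_mult[OF that]
      by (simp add: pullback_def tuples_def c_def)
    ultimately have "bdd_cohomologous2 H
        (\<lambda>x y. pullback H 2 \<psi> f [\<one>\<^bsub>H\<^esub>, x, x \<otimes>\<^bsub>H\<^esub> y]) (\<lambda>x y. ?g [\<one>\<^bsub>H\<^esub>, x, x \<otimes>\<^bsub>H\<^esub> y])"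
      using psi_hom prod_hom_hom by (simp add: bdd_cohomologous2_def)
    then have "(pullback H 2 \<psi> f, ?g) \<in> cohomologous H 2"
      using psi_hom prod_hom_hom f_cocycle G.is_group H.is_group
      by (intro H.bdd_cohomologous2_imp_cohomologous pullback_bdd_cocycle bdd_cocycles_scale)
    then have "?g \<in> Hb_map H 2 \<psi> C"
      using f by (auto simp: Hb_map_def)
    moreover have bdd: "bdd_below (sup_norm H 2 ` Hb_map H 2 \<psi> C)"
      by (intro bdd_belowI2[of _ 0] H.sup_norm_nonneg) (auto simp: Hb_map_def cohomologous_def bdd_cocycles_def)
    ultimately have "Hb_norm H 2 (Hb_map H 2 \<psi> C) \<le> sup_norm H 2 ?g"
      unfolding Hb_norm_def by (intro cINF_lower)
    also have "\<dots> \<le> sup_norm G 2 f / real m"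
      unfolding sup_norm_def[of H]
    proof (rule cSUP_least)
      show "tuples H 2 \<noteq> {}" by (rule H.tuples_nonempty)
      fix xs assume xs: "xs \<in> tuples H 2"
      then have "map ?\<Phi> xs \<in> tuples G 2" using prod_hom_hom by (rule map_hom_tuples)
      then have "\<bar>f (map ?\<Phi> xs)\<bar> \<le> sup_norm G 2 f"
        using f_cocycle by (intro sup_norm_upper) (auto simp: bdd_cocycles_def)
      then show "\<bar>?g xs\<bar> \<le> sup_norm G 2 f / real m"
        using m xs by (simp add: pullback_def abs_mult divide_right_mono)
    qed
    finally show ?thesis .
  qed
  \<comment> \<open>Cleared of the denominator, the left side is a lower bound of
    \<open>sup_norm G 2 f\<close> for all \<open>f \<in> C\<close>, hence of the infimum.\<close>
  then have "real m * Hb_norm H 2 (Hb_map H 2 \<psi> C) \<le> Hb_norm G 2 C"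
    unfolding Hb_norm_def[of G] using C_nonempty m
    by (intro cINF_greatest) (auto simp: field_simps)
  then show ?thesis using m by (simp add: field_simps)
qed

lemma Hb_map_norm_bounds:
  assumes "m > 0"
  shows "0 \<le> Hb_map_norm H G 2 \<psi>" "Hb_map_norm H G 2 \<psi> \<le> 1 / real m"
proof -
  let ?S = "{D. 0 \<le> D \<and> (\<forall>C \<in> Hb G 2. Hb_norm H 2 (Hb_map H 2 \<psi> C) \<le> D * Hb_norm G 2 C)}"
  \<comment> \<open>This element gives the upper bound and also shows that \<open>?S\<close> is
    nonempty, so that \<open>Inf ?S\<close> inherits the lower bound 0.\<close>
  have "1 / real m \<in> ?S" using Hb_norm_pullback_le[OF assms] by simp
  moreover have "bdd_below ?S" by (rule bdd_belowI[of _ 0]) simp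
  ultimately show "0 \<le> Hb_map_norm H G 2 \<psi>" "Hb_map_norm H G 2 \<psi> \<le> 1 / real m"
    unfolding Hb_map_norm_def by (blast intro: cInf_greatest, blast intro: cInf_lower)
qed

end


section \<open>Commuting copies of the symplectic group\<close>

lemma Sp_carrierI:
  assumes "A \<in> carrier_mat (2 * h) (2 * h)" "B \<in> carrier_mat (2 * h) (2 * h)"
    and "A * B = 1\<^sub>m (2 * h)" "B * A = 1\<^sub>m (2 * h)"
    and "\<And>v w. v \<in> carrier_vec (2 * h) \<Longrightarrow> w \<in> carrier_vec (2 * h) \<Longrightarrow>
      symp_form h (A *\<^sub>v v) (A *\<^sub>v w) = symp_form h v w"
  shows "A \<in> carrier (Sp h)"
  using assms by (auto simp: Sp_def invertible_mat_def inverts_mat_def intro!: exI[of _ B])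

lemma Sp_mat: "A \<in> carrier (Sp h) \<Longrightarrow> A \<in> carrier_mat (2 * h) (2 * h)"
  by (simp add: Sp_def)

lemma Sp_form:
  "A \<in> carrier (Sp h) \<Longrightarrow> v \<in> carrier_vec (2 * h) \<Longrightarrow> w \<in> carrier_vec (2 * h) \<Longrightarrow>
    symp_form h (A *\<^sub>v v) (A *\<^sub>v w) = symp_form h v w"
  by (simp add: Sp_def)

lemma Sp_inverse:
  assumes "A \<in> carrier (Sp h)"
  obtains B where "B \<in> carrier_mat (2 * h) (2 * h)" "A * B = 1\<^sub>m (2 * h)" "B * A = 1\<^sub>m (2 * h)"
proof -
  note A = Sp_mat[OF assms]
  from assms A obtain B where AB: "A * B = 1\<^sub>m (2 * h)" and BA: "B * A = 1\<^sub>m (dim_row B)"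
    by (auto simp: Sp_def invertible_mat_def inverts_mat_def)
  \<comment> \<open>\<open>invertible_mat\<close> does not state the size of the inverse; it is read
    off from the two product equations.\<close>
  have "dim_col B = 2 * h" using arg_cong[OF AB, of dim_col] by simp
  moreover have "dim_row B = 2 * h" using arg_cong[OF BA, of dim_col] A by simp
  ultimately show ?thesis using that[of B] AB BA by auto
qed

lemma mult_Sp [simp]: "A \<otimes>\<^bsub>Sp h\<^esub> B = A * B"
  by (simp add: Sp_def)

lemma one_Sp [simp]: "\<one>\<^bsub>Sp h\<^esub> = 1\<^sub>m (2 * h)"
  by (simp add: Sp_def)

lemma Sp_mult_closed:
  assumes "A \<in> carrier (Sp h)" "A' \<in> carrier (Sp h)"
  shows "A * A' \<in> carrier (Sp h)"
proof -
  obtain B where B: "B \<in> carrier_mat (2 * h) (2 * h)" "A * B = 1\<^sub>m (2 * h)" "B * A = 1\<^sub>m (2 * h)"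
    using Sp_inverse[OF assms(1)] .
  note A = Sp_mat[OF assms(1)] B and form = Sp_form[OF assms(1)]
  obtain B' where B': "B' \<in> carrier_mat (2 * h) (2 * h)" "A' * B' = 1\<^sub>m (2 * h)" "B' * A' = 1\<^sub>m (2 * h)"
    using Sp_inverse[OF assms(2)] .
  note A' = Sp_mat[OF assms(2)] B' and form' = Sp_form[OF assms(2)]
  show ?thesis
  proof (rule Sp_carrierI)
    show "A * A' \<in> carrier_mat (2 * h) (2 * h)" "B' * B \<in> carrier_mat (2 * h) (2 * h)"
      using A A' by auto
    have "A' * (B' * B) = B"
      using assoc_mult_mat[OF A'(1,2) A(2)] A'(3) left_mult_one_mat[OF A(2)] by simp
    then show "A * A' * (B' * B) = 1\<^sub>m (2 * h)"
      using assoc_mult_mat[OF A(1) A'(1) mult_carrier_mat[OF A'(2) A(2)]] A(3) by simp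
    have "B * (A * A') = A'"
      using assoc_mult_mat[OF A(2,1) A'(1)] A(4) left_mult_one_mat[OF A'(1)] by simp
    then show "B' * B * (A * A') = 1\<^sub>m (2 * h)"
      using assoc_mult_mat[OF A'(2) A(2) mult_carrier_mat[OF A(1) A'(1)]] A'(4) by simp
    fix v w :: "'a vec" assume "v \<in> carrier_vec (2 * h)" "w \<in> carrier_vec (2 * h)"
    then show "symp_form h (A * A' *\<^sub>v v) (A * A' *\<^sub>v w) = symp_form h v w"
      using A A' form form'
      by (simp add: assoc_mult_mat_vec[of _ "2 * h" "2 * h" _ "2 * h"]
        mult_mat_vec_carrier[of _ "2 * h" "2 * h"])
  qed
qed

lemma group_Sp: "group (Sp h :: 'a::comm_ring_1 mat monoid)"
proof (rule groupI)
  fix A A' A'' :: "'a mat"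
  assume A: "A \<in> carrier (Sp h)"
  show "\<one>\<^bsub>Sp h\<^esub> \<otimes>\<^bsub>Sp h\<^esub> A = A" using Sp_mat[OF A] by simp
  obtain B where B: "B \<in> carrier_mat (2 * h) (2 * h)" "A * B = 1\<^sub>m (2 * h)" "B * A = 1\<^sub>m (2 * h)"
    using Sp_inverse[OF A] .
  note B = Sp_mat[OF A] B and form = Sp_form[OF A]
  have "B \<in> carrier (Sp h)"
  proof (rule Sp_carrierI[of _ _ A])
    fix v w :: "'a vec" assume vw: "v \<in> carrier_vec (2 * h)" "w \<in> carrier_vec (2 * h)"
    \<comment> \<open>Hence invariance of the form under \<open>B\<close> is invariance under
      \<open>A\<close> read at \<open>B *\<^sub>v v\<close> and
      \<open>B *\<^sub>v w\<close>.\<close>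
    have "A *\<^sub>v (B *\<^sub>v u) = u" if "u \<in> carrier_vec (2 * h)" for u
      using assoc_mult_mat_vec[OF B(1,2) that] B(3) that by simp
    then show "symp_form h (B *\<^sub>v v) (B *\<^sub>v w) = symp_form h v w"
      using form[of "B *\<^sub>v v" "B *\<^sub>v w"] vw B by simp
  qed (use B in auto)
  then show "\<exists>B \<in> carrier (Sp h). B \<otimes>\<^bsub>Sp h\<^esub> A = \<one>\<^bsub>Sp h\<^esub>" using B by auto
  assume A': "A' \<in> carrier (Sp h)"
  then show "A \<otimes>\<^bsub>Sp h\<^esub> A' \<in> carrier (Sp h)" using A by (simp add: Sp_mult_closed)
  assume "A'' \<in> carrier (Sp h)"
  then show "A \<otimes>\<^bsub>Sp h\<^esub> A' \<otimes>\<^bsub>Sp h\<^esub> A'' = A \<otimes>\<^bsub>Sp h\<^esub> (A' \<otimes>\<^bsub>Sp h\<^esub> A'')"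
    using A A' by (simp add: assoc_mult_mat[OF Sp_mat Sp_mat Sp_mat])
next
  show "\<one>\<^bsub>Sp h\<^esub> \<in> carrier (Sp h)" by (auto intro!: Sp_carrierI[of _ _ "1\<^sub>m (2 * h)"])
qed

section \<open>Stabilization is a homomorphism of symplectic groups\<close>

lemma stab_eq:
  assumes "A \<in> carrier_mat n n"
  shows "stab k A = four_block_mat A (0\<^sub>m n (2 * k)) (0\<^sub>m (2 * k) n) (1\<^sub>m (2 * k))"
  using assms by (simp add: stab_def)

lemma stab_carrier: "A \<in> carrier_mat (2 * h) (2 * h) \<Longrightarrow> stab k A \<in> carrier_mat (2 * (h + k)) (2 * (h + k))"
  by (simp add: stab_eq distrib_left)

lemma stab_mult:
  assumes "A \<in> carrier_mat n n" "B \<in> carrier_mat n n"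
  shows "stab k (A * B) = stab k A * stab k (B :: 'a::comm_ring_1 mat)"
  using assms
  by (simp add: stab_eq[of _ n] mult_four_block_mat[of _ n n _ "2 * k" _ "2 * k" _ _ n _ "2 * k"]
    left_mult_zero_mat[of _ n n])

lemma stab_one: "stab k (1\<^sub>m (2 * h)) = 1\<^sub>m (2 * (h + k))"
  by (simp add: stab_eq[of _ "2 * h"] distrib_left)

text \<open>Each hyperbolic pair occupies two adjacent coordinates, so splitting vectors after
  \<open>2 * h\<close> entries splits the sum over pairs at \<open>i = h\<close>.\<close>

lemma symp_form_append:
  assumes "a \<in> carrier_vec (2 * h)" "a' \<in> carrier_vec (2 * h)"
    and "d \<in> carrier_vec (2 * k)" "d' \<in> carrier_vec (2 * k)"
  shows "symp_form (h + k) (a @\<^sub>v d) (a' @\<^sub>v d') = symp_form h a a' + symp_form k d d'"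
proof -
  let ?f = "\<lambda>i. (a @\<^sub>v d) $ (2 * i) * (a' @\<^sub>v d') $ (2 * i + 1)
    - (a @\<^sub>v d) $ (2 * i + 1) * (a' @\<^sub>v d') $ (2 * i)"
  have "symp_form (h + k) (a @\<^sub>v d) (a' @\<^sub>v d') = (\<Sum>i<h. ?f i) + (\<Sum>i<k. ?f (h + i))"
    unfolding symp_form_def lessThan_atLeast0
    using sum.atLeastLessThan_concat[of 0 h "h + k" ?f] sum.shift_bounds_nat_ivl[of ?f 0 h k]
    by (simp add: add.commute)
  also have "(\<Sum>i<h. ?f i) = symp_form h a a'"
    unfolding symp_form_def using assms by (intro sum.cong) auto
  also have "(\<Sum>i<k. ?f (h + i)) = symp_form k d d'"
    unfolding symp_form_def using assms by (intro sum.cong) auto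
  finally show ?thesis .
qed

lemma stab_closed:
  assumes "A \<in> carrier (Sp h)"
  shows "stab k A \<in> carrier (Sp (h + k))"
proof -
  obtain B where B: "B \<in> carrier_mat (2 * h) (2 * h)" "A * B = 1\<^sub>m (2 * h)" "B * A = 1\<^sub>m (2 * h)"
    using Sp_inverse[OF assms] .
  note A = Sp_mat[OF assms] B and form = Sp_form[OF assms]
  show ?thesis
  proof (rule Sp_carrierI)
    show "stab k A * stab k B = 1\<^sub>m (2 * (h + k))" "stab k B * stab k A = 1\<^sub>m (2 * (h + k))"
      using A by (simp_all add: stab_one flip: stab_mult)
    fix v w :: "'a vec" assume vw: "v \<in> carrier_vec (2 * (h + k))" "w \<in> carrier_vec (2 * (h + k))"
    define a d where "a v = vec_first v (2 * h)" and "d v = vec_last v (2 * k)" for v :: "'a vec"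
    have split: "u = a u @\<^sub>v d u" if "u \<in> carrier_vec (2 * (h + k))" for u
      using that by (simp add: a_def d_def distrib_left)
    have carr: "a u \<in> carrier_vec (2 * h)" "d u \<in> carrier_vec (2 * k)" for u
      by (simp_all add: a_def d_def)
    have "stab k A *\<^sub>v u = (A *\<^sub>v a u) @\<^sub>v d u" if "u \<in> carrier_vec (2 * (h + k))" for u
      using mult_mat_vec_split[OF A(1) one_carrier_mat carr(1)[of u] carr(2)[of u]]
      unfolding stab_eq[OF A(1)] one_mult_mat_vec[OF carr(2)] split[OF that, symmetric] .
    moreover have "A *\<^sub>v a u \<in> carrier_vec (2 * h)" for u using A(1) carr(1) by simp
    ultimately have "symp_form (h + k) (stab k A *\<^sub>v v) (stab k A *\<^sub>v w)
        = symp_form (h + k) (a v @\<^sub>v d v) (a w @\<^sub>v d w)"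
      using vw by (simp add: symp_form_append carr form)
    then show "symp_form (h + k) (stab k A *\<^sub>v v) (stab k A *\<^sub>v w) = symp_form (h + k) v w"
      using split[OF vw(1)] split[OF vw(2)] by simp
  qed (use A stab_carrier in auto)
qed

lemma stab_hom: "stab k \<in> hom (Sp h) (Sp (h + k) :: 'a::comm_ring_1 mat monoid)"
  by (rule homI) (simp_all add: stab_closed stab_mult[OF Sp_mat Sp_mat])

section \<open>Permutation matrices exchanging two blocks of coordinates\<close>

definition block_swap :: "nat \<Rightarrow> nat \<Rightarrow> nat \<Rightarrow> nat" where
  "block_swap n s p = (if p < n then p + s else if s \<le> p \<and> p < s + n then p - s else p)"

text \<open>The hypothesis covers two cases: for \<open>s = 0\<close> the map is the identity, and
  for \<open>n \<le> s\<close> it exchanges the disjoint intervals of length \<open>n\<close>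
  starting at 0 and at \<open>s\<close>.\<close>

lemma block_swap_involution: "s = 0 \<or> n \<le> s \<Longrightarrow> block_swap n s (block_swap n s p) = p"
  by (auto simp: block_swap_def)

lemma block_swap_eq_iff:
  "s = 0 \<or> n \<le> s \<Longrightarrow> p = block_swap n s q \<longleftrightarrow> q = block_swap n s p"
  using block_swap_involution by metis

lemma block_swap_less: "s + n \<le> N \<Longrightarrow> p < N \<Longrightarrow> block_swap n s p < N"
  by (auto simp: block_swap_def)

text \<open>Used to see that conjugation by the swap moves the support of a matrix from the first
  block to the block at \<open>s\<close>.\<close>

lemma block_swap_ge: "s = 0 \<or> n \<le> s \<Longrightarrow> p \<notin> {s..<s + n} \<Longrightarrow> n \<le> block_swap n s p"
  by (auto simp: block_swap_def)

text \<open>The swap of coordinates moves each hyperbolic pair as a whole and keeps the order within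
  it, which is why it is symplectic.\<close>

lemma block_swap_double:
  "block_swap (2 * n) (2 * s) (2 * p) = 2 * block_swap n s p"
  "block_swap (2 * n) (2 * s) (2 * p + 1) = 2 * block_swap n s p + 1"
  by (auto simp: block_swap_def)

text \<open>When \<open>block_swap n s\<close> is an involution and the blocks fit into
  \<open>N\<close>, this permutation matrix is its own inverse, so conjugation by it is
  multiplication by the same matrix on both sides.\<close>

definition swap_mat :: "nat \<Rightarrow> nat \<Rightarrow> nat \<Rightarrow> 'a::comm_ring_1 mat" where
  "swap_mat N n s = mat N N (\<lambda>(r, c). if c = block_swap n s r then 1 else 0)"

context
  fixes N n s :: nat
  assumes s: "s = 0 \<or> n \<le> s" and N: "s + n \<le> N"
begin

lemma swap_mat_carrier: "swap_mat N n s \<in> carrier_mat N N"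
  by (simp add: swap_mat_def)

lemma swap_mat_mult_vec:
  assumes "v \<in> carrier_vec N" "r < N"
  shows "(swap_mat N n s *\<^sub>v v) $ r = v $ block_swap n s r"
proof -
  have "(swap_mat N n s *\<^sub>v v) $ r = (\<Sum>l = 0..<N. (if l = block_swap n s r then 1 else 0) * v $ l)"
    using assms by (simp add: swap_mat_def scalar_prod_def)
  also have "\<dots> = (\<Sum>l = 0..<N. if l = block_swap n s r then v $ l else 0)"
    by (intro sum.cong) auto
  finally show ?thesis using block_swap_less[OF N assms(2)] by simp
qed

lemma swap_mat_mult_left:
  assumes "X \<in> carrier_mat N N" "r < N" "c < N"
  shows "(swap_mat N n s * X) $$ (r, c) = X $$ (block_swap n s r, c)"
  using swap_mat_mult_vec[of "col X c" r] assms block_swap_less[OF N assms(2)]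
  by (simp add: carrier_matD[OF swap_mat_carrier])

lemma swap_mat_mult_right:
  assumes "X \<in> carrier_mat N N" "r < N" "c < N"
  shows "(X * swap_mat N n s) $$ (r, c) = X $$ (r, block_swap n s c)"
proof -
  have "(X * swap_mat N n s) $$ (r, c)
      = (\<Sum>l = 0..<N. X $$ (r, l) * (if c = block_swap n s l then 1 else 0))"
    using assms by (simp add: swap_mat_def scalar_prod_def)
  also have "\<dots> = (\<Sum>l = 0..<N. if l = block_swap n s c then X $$ (r, l) else 0)"
    using block_swap_eq_iff[OF s] by (intro sum.cong) auto
  finally show ?thesis using block_swap_less[OF N assms(3)] by simp
qed

lemma swap_mat_involution: "swap_mat N n s * swap_mat N n s = 1\<^sub>m N"
proof (rule eq_matI)
  fix r c assume "r < dim_row (1\<^sub>m N)" "c < dim_col (1\<^sub>m N)"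
  then have rc: "r < N" "c < N" by simp_all
  show "(swap_mat N n s * swap_mat N n s) $$ (r, c) = 1\<^sub>m N $$ (r, c)"
    unfolding swap_mat_mult_left[OF swap_mat_carrier rc]
    using rc block_swap_less[OF N rc(1)] by (auto simp: swap_mat_def block_swap_involution[OF s])
qed (simp_all add: swap_mat_def)

lemma swap_conjugate_index:
  assumes "X \<in> carrier_mat N N" "r < N" "c < N"
  shows "(swap_mat N n s * (X * swap_mat N n s)) $$ (r, c)
    = X $$ (block_swap n s r, block_swap n s c)"
  using assms swap_mat_mult_left[of "X * swap_mat N n s"] swap_mat_mult_right[OF assms(1)]
    block_swap_less[OF N] swap_mat_carrier by (metis mult_carrier_mat)

end

text \<open>Permuting hyperbolic pairs only reindexes the sum that defines
  \<open>symp_form\<close>.\<close>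

lemma swap_mat_Sp:
  assumes s: "s = 0 \<or> n \<le> s" and N: "s + n \<le> N"
  shows "(swap_mat (2 * N) (2 * n) (2 * s) :: 'a::comm_ring_1 mat) \<in> carrier (Sp N)"
proof (rule Sp_carrierI)
  let ?w = "swap_mat (2 * N) (2 * n) (2 * s) :: 'a mat"
  have s2: "2 * s = 0 \<or> 2 * n \<le> 2 * s" and N2: "2 * s + 2 * n \<le> 2 * N" using s N by auto
  show "?w \<in> carrier_mat (2 * N) (2 * N)" "?w \<in> carrier_mat (2 * N) (2 * N)"
    by (rule swap_mat_carrier[OF s2 N2])+
  show "?w * ?w = 1\<^sub>m (2 * N)" "?w * ?w = 1\<^sub>m (2 * N)"
    by (rule swap_mat_involution[OF s2 N2])+
  fix v u :: "'a vec" assume vu: "v \<in> carrier_vec (2 * N)" "u \<in> carrier_vec (2 * N)"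
  let ?f = "\<lambda>i. v $ (2 * i) * u $ (2 * i + 1) - v $ (2 * i + 1) * u $ (2 * i)"
  have "symp_form N (?w *\<^sub>v v) (?w *\<^sub>v u) = (\<Sum>i<N. ?f (block_swap n s i))"
    unfolding symp_form_def using vu
    by (intro sum.cong) (simp_all add: swap_mat_mult_vec[OF s2 N2] block_swap_double[simplified])
  also have "\<dots> = (\<Sum>i<N. ?f i)"
    by (rule sum.reindex_bij_witness[where i = "block_swap n s" and j = "block_swap n s"])
      (use block_swap_less[OF N] block_swap_involution[OF s] in auto)
  finally show "symp_form N (?w *\<^sub>v v) (?w *\<^sub>v u) = symp_form N v u"
    by (simp add: symp_form_def)
qed

text \<open>Disjointness of \<open>S\<close> and \<open>T\<close> forces
  \<open>(A - 1) (B - 1) = 0\<close>. The resulting formula is symmetric in \<open>A\<close> and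
  \<open>B\<close>, so two such matrices commute.\<close>

lemma mult_disjoint_support:
  fixes A B :: "'a::comm_ring_1 mat"
  assumes A: "A \<in> carrier_mat n n" and B: "B \<in> carrier_mat n n"
    and A_supp: "\<And>r c. r < n \<Longrightarrow> c < n \<Longrightarrow> r \<notin> S \<or> c \<notin> S \<Longrightarrow> A $$ (r, c) = 1\<^sub>m n $$ (r, c)"
    and B_supp: "\<And>r c. r < n \<Longrightarrow> c < n \<Longrightarrow> r \<notin> T \<or> c \<notin> T \<Longrightarrow> B $$ (r, c) = 1\<^sub>m n $$ (r, c)"
    and "S \<inter> T = {}"
  shows "A * B = A + B - 1\<^sub>m n"
proof (rule eq_matI)
  fix r c assume "r < dim_row (A + B - 1\<^sub>m n)" "c < dim_col (A + B - 1\<^sub>m n)"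
  then have rc: "r < n" "c < n" by auto
  have "(\<Sum>l = 0..<n. (A $$ (r, l) - 1\<^sub>m n $$ (r, l)) * (B $$ (l, c) - 1\<^sub>m n $$ (l, c))) = 0"
  proof (rule sum.neutral, rule ballI)
    fix l assume "l \<in> {0..<n}"
    then have "A $$ (r, l) = 1\<^sub>m n $$ (r, l) \<or> B $$ (l, c) = 1\<^sub>m n $$ (l, c)"
      using A_supp[of r l] B_supp[of l c] \<open>S \<inter> T = {}\<close> rc by fastforce
    then show "(A $$ (r, l) - 1\<^sub>m n $$ (r, l)) * (B $$ (l, c) - 1\<^sub>m n $$ (l, c)) = 0"
      by (elim disjE) simp_all
  qed
  \<comment> \<open>The expansion \<open>A B - A - B + 1\<close>, with identity entries written as
    conditions on \<open>l\<close> so that the last three sums collapse to single terms.\<close>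
  moreover have "(\<Sum>l = 0..<n. (A $$ (r, l) - 1\<^sub>m n $$ (r, l)) * (B $$ (l, c) - 1\<^sub>m n $$ (l, c)))
      = (\<Sum>l = 0..<n. A $$ (r, l) * B $$ (l, c) - (if l = c then A $$ (r, l) else 0)
          - (if l = r then B $$ (l, c) else 0) + (if l = r then 1\<^sub>m n $$ (l, c) else 0))"
    using rc by (intro sum.cong) (auto simp: algebra_simps)
  ultimately show "(A * B) $$ (r, c) = (A + B - 1\<^sub>m n) $$ (r, c)"
    using A B rc by (simp add: sum.distrib sum_subtractf scalar_prod_def algebra_simps)
qed (use A B in auto)

text \<open>Conjugation by \<open>w i\<close> moves the first block of \<open>2 * h\<close>
  coordinates to the one starting at \<open>2 * (i * h)\<close>. The bound on \<open>m * h\<close>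
  makes all \<open>m\<close> blocks fit, and their disjointness makes the copies commute.\<close>

lemma stab_conjugates_commuting:
  assumes "m * h \<le> h + k"
  defines "w \<equiv> \<lambda>i. swap_mat (2 * (h + k)) (2 * h) (2 * (i * h))"
  shows "conjugate_commuting_homs (Sp (h + k)) (Sp h :: 'a::comm_ring_1 mat monoid)
           (\<lambda>i A. w i * (stab k A * w i)) m (stab k) w"
proof -
  let ?N = "2 * (h + k)" and ?G = "Sp (h + k) :: 'a mat monoid" and ?H = "Sp h :: 'a mat monoid"
  interpret G: group ?G by (rule group_Sp)
  interpret H: group ?H by (rule group_Sp)
  define block where "block i = {2 * (i * h)..<2 * (i * h) + 2 * h}" for i
  \<comment> \<open>For \<open>i = 0\<close> the swap is trivial and the copy is the stabilization
    itself; otherwise block \<open>i\<close> is disjoint from the first.\<close>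
  have shift: "i * h = 0 \<or> h \<le> i * h" for i by (cases i) auto
  have bound: "i * h + h \<le> h + k" if "i < m" for i
    using mult_le_mono1[of "Suc i" m h] that assms(1) by simp
  have w_closed: "w i \<in> carrier ?G" if "i < m" for i
    unfolding w_def using swap_mat_Sp[OF shift bound[OF that]] by simp
  have shift2: "2 * (i * h) = 0 \<or> 2 * h \<le> 2 * (i * h)" for i using shift[of i] by auto
  have bound2: "2 * (i * h) + 2 * h \<le> ?N" if "i < m" for i using bound[OF that] by simp
  have ww: "w i * w i = 1\<^sub>m ?N" if "i < m" for i
    unfolding w_def by (rule swap_mat_involution[OF shift2 bound2[OF that]])
  have closed: "w i * (stab k A * w i) \<in> carrier ?G" if "i < m" "A \<in> carrier ?H" for i A
    using G.m_closed[OF w_closed[OF that(1)] G.m_closed[OF stab_closed[OF that(2)] w_closed[OF that(1)]]]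
    by simp
  have cancel: "w i * (w i * X) = X" if "i < m" "X \<in> carrier ?G" for i X
    using G.m_assoc[OF w_closed w_closed, OF that(1) that(1) that(2)] G.l_one[OF that(2)] ww[OF that(1)]
    by simp
  have supp: "(w i * (stab k A * w i)) $$ (r, c) = 1\<^sub>m ?N $$ (r, c)"
    if "i < m" "A \<in> carrier ?H" "r < ?N" "c < ?N" "r \<notin> block i \<or> c \<notin> block i" for i A r c
  proof -
    let ?\<sigma> = "block_swap (2 * h) (2 * (i * h))"
    have lt: "?\<sigma> r < ?N" "?\<sigma> c < ?N" using block_swap_less[OF bound2[OF that(1)]] that by auto
    have "?\<sigma> p \<ge> 2 * h" if "p \<notin> block i" for p
      using block_swap_ge[OF shift2] that unfolding block_def .
    \<comment> \<open>An entry of \<open>stab k A\<close> can differ from the identity only if both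
      its indices are below \<open>2 * h\<close>.\<close>
    then have out: "?\<sigma> r \<ge> 2 * h \<or> ?\<sigma> c \<ge> 2 * h" using that by blast
    have "(w i * (stab k A * w i)) $$ (r, c) = stab k A $$ (?\<sigma> r, ?\<sigma> c)"
      unfolding w_def
      using swap_conjugate_index[OF shift2 bound2[OF that(1)] stab_carrier[OF Sp_mat[OF that(2)]]] that
      by blast
    also have "\<dots> = 1\<^sub>m ?N $$ (?\<sigma> r, ?\<sigma> c)"
      using out lt Sp_mat[OF that(2)] by (auto simp: stab_def)
    also have "\<dots> = 1\<^sub>m ?N $$ (r, c)"
    proof -
      have "?\<sigma> r = ?\<sigma> c \<longleftrightarrow> r = c" using block_swap_involution[OF shift2] by metis
      then show ?thesis using lt that(3,4) by simp
    qed
    finally show ?thesis .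
  qed
  have disjoint: "block i \<inter> block j = {}" if "i < j" for i j
    using mult_le_mono1[of "Suc i" j h] that by (auto simp: block_def)
  have assoc: "X * Y * Z = X * (Y * Z)" if "X \<in> carrier ?G" "Y \<in> carrier ?G" "Z \<in> carrier ?G" for X Y Z
    using G.m_assoc[OF that] by simp
  have mult: "X * Y \<in> carrier ?G" if "X \<in> carrier ?G" "Y \<in> carrier ?G" for X Y
    using Sp_mult_closed[OF that] .
  show ?thesis
  proof
    show "(\<lambda>A. w i * (stab k A * w i)) \<in> hom ?H ?G" if "i < m" for i
    proof (rule homI)
      fix A B assume AB: "A \<in> carrier ?H" "B \<in> carrier ?H"
      show "w i * (stab k (A \<otimes>\<^bsub>?H\<^esub> B) * w i)
          = w i * (stab k A * w i) \<otimes>\<^bsub>?G\<^esub> (w i * (stab k B * w i))"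
        using that AB w_closed[OF that] stab_closed[OF AB(1), of k] stab_closed[OF AB(2), of k]
        by (simp add: assoc mult cancel stab_mult[OF Sp_mat[OF AB(1)] Sp_mat[OF AB(2)]])
    qed (use that closed in auto)
    show "w i * (stab k A * w i) \<otimes>\<^bsub>?G\<^esub> (w j * (stab k B * w j))
        = w j * (stab k B * w j) \<otimes>\<^bsub>?G\<^esub> (w i * (stab k A * w i))"
      if ij: "i < m" "j < m" "i \<noteq> j" and AB: "A \<in> carrier ?H" "B \<in> carrier ?H" for i j A B
    proof -
      let ?A = "w i * (stab k A * w i)" and ?B = "w j * (stab k B * w j)"
      have carr: "?A \<in> carrier_mat ?N ?N" "?B \<in> carrier_mat ?N ?N"
        using Sp_mat[OF closed[OF ij(1) AB(1)]] Sp_mat[OF closed[OF ij(2) AB(2)]] .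
      have disj: "block i \<inter> block j = {}" "block j \<inter> block i = {}"
        using disjoint[of i j] disjoint[of j i] ij(3) by (auto simp: neq_iff)
      have "?A * ?B = ?A + ?B - 1\<^sub>m ?N"
        by (rule mult_disjoint_support[OF carr _ _ disj(1)])
          (rule supp[OF ij(1) AB(1)] supp[OF ij(2) AB(2)]; assumption)+
      moreover have "?B * ?A = ?B + ?A - 1\<^sub>m ?N"
        by (rule mult_disjoint_support[OF carr(2,1) _ _ disj(2)])
          (rule supp[OF ij(1) AB(1)] supp[OF ij(2) AB(2)]; assumption)+
      moreover note comm_add_mat[OF carr]
      ultimately show ?thesis by (simp only: mult_Sp)
    qed
    show "stab k \<in> hom ?H ?G" by (rule stab_hom)
    show "w i \<in> carrier ?G" if "i < m" for i using w_closed[OF that] .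
    show "w i * (stab k A * w i) \<otimes>\<^bsub>?G\<^esub> w i = w i \<otimes>\<^bsub>?G\<^esub> stab k A"
      if "i < m" "A \<in> carrier ?H" for i A
      using that w_closed[OF that(1)] stab_closed[OF that(2), of k]
        G.r_one[OF stab_closed[OF that(2), of k]]
      by (simp add: assoc mult ww)
  qed
qed

text \<open>The number of blocks \<open>(h + k) div h\<close> grows linearly in \<open>k\<close>, so
  the norm is squeezed between 0 and \<open>h / (k + 1)\<close>. The argument works over any
  commutative ring, in particular over both rings of the theorem.\<close>

lemma Hb_map_norm_stab_tendsto_0:
  assumes h: "h \<ge> 1"
  shows "(\<lambda>k. Hb_map_norm (Sp h :: 'a::comm_ring_1 mat monoid) (Sp (h + k)) 2 (stab k)) \<longlonglongrightarrow> 0"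
proof -
  have bounds: "0 \<le> Hb_map_norm (Sp h :: 'a mat monoid) (Sp (h + k)) 2 (stab k)"
    "Hb_map_norm (Sp h :: 'a mat monoid) (Sp (h + k)) 2 (stab k) \<le> real h / real (Suc k)" for k
  proof -
    let ?m = "(h + k) div h"
    have m: "?m > 0" using h by (simp add: div_greater_zero_iff)
    interpret conjugate_commuting_homs "Sp (h + k)" "Sp h :: 'a mat monoid"
      "\<lambda>i A. swap_mat (2 * (h + k)) (2 * h) (2 * (i * h)) * (stab k A * swap_mat (2 * (h + k)) (2 * h) (2 * (i * h)))"
      ?m "stab k" "\<lambda>i. swap_mat (2 * (h + k)) (2 * h) (2 * (i * h))"
      by (rule stab_conjugates_commuting) simp
    show "0 \<le> Hb_map_norm (Sp h :: 'a mat monoid) (Sp (h + k)) 2 (stab k)"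
      by (rule Hb_map_norm_bounds(1)[OF m])
    \<comment> \<open>The remainder of \<open>h + k\<close> modulo \<open>h\<close> is at most
      \<open>h - 1\<close>, which leaves at least \<open>k + 1\<close> for
      \<open>h * ?m\<close>.\<close>
    have "Suc k \<le> h * ?m"
      using mod_less_divisor[of h "h + k"] mult_div_mod_eq[of h "h + k"] h by linarith
    then have "real (Suc k) \<le> real h * real ?m" by (metis of_nat_le_iff of_nat_mult)
    then have "1 / real ?m \<le> real h / real (Suc k)" using m by (simp add: field_simps)
    with Hb_map_norm_bounds(2)[OF m]
    show "Hb_map_norm (Sp h :: 'a mat monoid) (Sp (h + k)) 2 (stab k) \<le> real h / real (Suc k)"
      by linarith
  qed
  have "(\<lambda>k. real h / real (Suc k)) \<longlonglongrightarrow> 0"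
    using tendsto_mult_right_zero[OF lim_inverse_n', of "real h"]
    by (intro LIMSEQ_Suc) (simp add: divide_inverse)
  then show ?thesis
    by (rule tendsto_sandwich[OF _ _ tendsto_const, rotated 2]) (simp_all add: bounds del: of_nat_Suc)
qed

theorem mainTheorem8:
  fixes h :: nat
  assumes "h \<ge> 1"
  shows "(\<lambda>k. Hb_map_norm (Sp h :: int mat monoid) (Sp (h + k)) 2 (stab k)) \<longlonglongrightarrow> 0 \<and>
         (\<lambda>k. Hb_map_norm (Sp h :: real mat monoid) (Sp (h + k)) 2 (stab k)) \<longlonglongrightarrow> 0"
  by (intro conjI Hb_map_norm_stab_tendsto_0 assms)

end
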